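(* Let $n\ge 1$, $N=\{1,\dots,n\}$, $\sigma\ge 0$, $a_i>0$ for $i\in N$, and $$F=\Big\{(x,y,z)\in\{0,1\}^N\times\mathbb{R}_+^N\times\mathbb{R}_+ :\ \sigma+\sum_{i\in N}a_iy_i^2\le z^2,\ \mathbf{0}\le y\le x\Big\}.$$ Let $S\subseteq N$, let $((1),(2),\dots,(|S|))$ be any permutation of $S$, put $\sigma_{S(0)}=\sigma$ and $\sigma_{S(i)}=a_{(i)}+\sigma_{S(i-1)}$ for $i=1,\dots,|S|$, and define $\pi_S,\alpha_S\in\mathbb{R}^S$ by $$(\pi_S)_{(i)}=\sqrt{\sigma_{S(i)}}-\sqrt{\sigma_{S(i-1)}},\qquad (\alpha_S)_{(i)}=\frac{a_{(i)}}{\sqrt{\sigma_{S(i)}}},\qquad i=1,\dots,|S|.$$ Then the inequality $$\Big(\big(\pi_S'x_S+\sqrt{\sigma}-\alpha_S'(x_S-y_S)\big)^+\Big)^2+\sum_{i\in N\setminus S}a_iy_i^2\le z^2$$ is valid for $F$, i.e. it holds for every $(x,y,z)\in F$.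
   Context: $\mathbf{0}$ is the vector of zeros, $'$ denotes transpose, vector inequalities are componentwise, $x_S,y_S$ are the subvectors of $x,y$ indexed by $S$, and $(\cdot)^+=\max\{\cdot,0\}$. *)

theory Defs
  imports "HOL-Analysis.Analysis"
begin

text \<open>
  A vector indexed by a finite set \<open>I\<close> of naturals is a function \<open>nat \<Rightarrow> real\<close>, extensional
  on \<open>I\<close> (equal to \<open>undefined\<close> elsewhere).
  The data \<open>a\<close> need not be extensional; only its values on \<open>{1..n}\<close> matter.
\<close>

definition mixed_set ::
  "nat \<Rightarrow> real \<Rightarrow> (nat \<Rightarrow> real) \<Rightarrow> ((nat \<Rightarrow> real) \<times> (nat \<Rightarrow> real) \<times> real) set" where
  "mixed_set n \<sigma> a =
     {(x, y, z).
        x \<in> {1..n} \<rightarrow>\<^sub>E {0, 1} \<and> y \<in> {1..n} \<rightarrow>\<^sub>E {0..} \<and> z \<in> {0..} \<and>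
        \<sigma> + (\<Sum>i\<in>{1..n}. a i * (y i)\<^sup>2) \<le> z\<^sup>2 \<and>
        (\<forall>i\<in>{1..n}. 0 \<le> y i \<and> y i \<le> x i)}"

text \<open>
  In what follows \<open>p\<close> is the ordering of \<open>S\<close>: a bijection from \<open>{1..card S}\<close> onto \<open>S\<close>, where
  \<open>p i\<close> is the \<open>i\<close>-th element.
\<close>

fun partial_sigma :: "real \<Rightarrow> (nat \<Rightarrow> real) \<Rightarrow> (nat \<Rightarrow> nat) \<Rightarrow> nat \<Rightarrow> real" where
  "partial_sigma \<sigma> a p 0 = \<sigma>"
| "partial_sigma \<sigma> a p (Suc i) = a (p (Suc i)) + partial_sigma \<sigma> a p i"

text \<open>
  The coefficient vectors are indexed by the elements \<open>j\<close> of \<open>S\<close>, so the position \<open>i\<close> with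
  \<open>p i = j\<close> is recovered first; the two lemmas give the coefficients by position.
\<close>

definition pi_coeff ::
  "real \<Rightarrow> (nat \<Rightarrow> real) \<Rightarrow> nat set \<Rightarrow> (nat \<Rightarrow> nat) \<Rightarrow> nat \<Rightarrow> real" where
  "pi_coeff \<sigma> a S p =
     (\<lambda>j\<in>S. let i = the_inv_into {1..card S} p j
            in sqrt (partial_sigma \<sigma> a p i) - sqrt (partial_sigma \<sigma> a p (i - 1)))"

definition alpha_coeff ::
  "real \<Rightarrow> (nat \<Rightarrow> real) \<Rightarrow> nat set \<Rightarrow> (nat \<Rightarrow> nat) \<Rightarrow> nat \<Rightarrow> real" where
  "alpha_coeff \<sigma> a S p =
     (\<lambda>j\<in>S. let i = the_inv_into {1..card S} p j
            in a (p i) / sqrt (partial_sigma \<sigma> a p i))"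

lemma pi_coeff_at:
  assumes "bij_betw p {1..card S} S" "i \<in> {1..card S}"
  shows "pi_coeff \<sigma> a S p (p i) =
    sqrt (partial_sigma \<sigma> a p i) - sqrt (partial_sigma \<sigma> a p (i - 1))"
proof -
  have "p i \<in> S" using assms by (rule bij_betw_apply)
  moreover have "the_inv_into {1..card S} p (p i) = i"
    using assms by (simp add: bij_betw_def the_inv_into_f_f)
  ultimately show ?thesis by (simp add: pi_coeff_def)
qed

lemma alpha_coeff_at:
  assumes "bij_betw p {1..card S} S" "i \<in> {1..card S}"
  shows "alpha_coeff \<sigma> a S p (p i) = a (p i) / sqrt (partial_sigma \<sigma> a p i)"
proof -
  have "p i \<in> S" using assms by (rule bij_betw_apply)
  moreover have "the_inv_into {1..card S} p (p i) = i"
    using assms by (simp add: bij_betw_def the_inv_into_f_f)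
  ultimately show ?thesis by (simp add: alpha_coeff_def)
qed

end

theory Submission
  imports Defs
begin

text \<open>
  With \<open>L\<close> the linear expression inside the positive part, it suffices to show
  \<open>L \<le> sqrt (\<sigma> + (\<Sum>i\<in>S. a i * (y i)\<^sup>2))\<close>: both sides of \<open>max L 0 \<le> \<dots>\<close> may then be
  squared, and adding the terms outside \<open>S\<close> gives at most \<open>z\<^sup>2\<close>.

  The bound on \<open>L\<close> is built up one element of \<open>S\<close> at a time in the order \<open>p\<close>. An element with
  \<open>x = 0\<close> forces \<open>y = 0\<close> and changes neither side. An element with \<open>x = 1\<close> raises the right-hand
  side from \<open>sqrt t\<close> to \<open>sqrt (t + a * y\<^sup>2)\<close>, where \<open>t\<close> is the part accumulated so far. As \<open>y \<le> 1\<close>,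
  \<open>t\<close> never exceeds the corresponding partial sum \<open>s\<close> of \<open>\<sigma>\<close> and the \<open>a i\<close>, so by concavity
  of the square root the increase is at least \<open>sqrt (s + a * y\<^sup>2) - sqrt s\<close>. This is a convex
  function of \<open>y\<close>, and the increase of \<open>L\<close>, namely
  \<open>sqrt (s + a) - sqrt s - a / sqrt (s + a) * (1 - y)\<close>, is its tangent line at \<open>y = 1\<close>.
\<close>

text \<open>
  Concavity of the square root, in the form of diminishing increments (submodularity).
\<close>

lemma sqrt_increment_antimono:
  assumes "0 \<le> t" "t \<le> s" "0 \<le> c"
  shows "sqrt (s + c) - sqrt s \<le> sqrt (t + c) - sqrt t"
proof -
  have "sqrt ((s + c) * t) \<le> sqrt ((t + c) * s)"
    using assms by (intro real_sqrt_le_mono) (simp add: algebra_simps mult_left_mono)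
  then have "sqrt (s + c) * sqrt t \<le> sqrt (t + c) * sqrt s"
    by (simp only: real_sqrt_mult)
  then have "(sqrt (s + c) + sqrt t)\<^sup>2 \<le> (sqrt (t + c) + sqrt s)\<^sup>2"
    using assms by (simp add: power2_sum)
  then have "sqrt (s + c) + sqrt t \<le> sqrt (t + c) + sqrt s"
    by (rule power2_le_imp_le) (use assms in simp)
  then show ?thesis by simp
qed

text \<open>
  The left-hand side is the tangent at \<open>y = 1\<close> of the right-hand side, which is the Euclidean norm
  of \<open>(sqrt s, sqrt a * y)\<close>. After multiplication by \<open>sqrt (s + a)\<close> the claim is the
  Cauchy-Schwarz inequality for this vector and \<open>(sqrt s, sqrt a)\<close>.
\<close>

lemma sqrt_quadratic_ge_tangent:
  fixes a s y :: real
  assumes "0 \<le> s" "0 < a"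
  shows "sqrt (s + a) - a / sqrt (s + a) * (1 - y) \<le> sqrt (s + a * y\<^sup>2)"
proof -
  have pos: "sqrt (s + a) > 0" using assms by simp
  have "(s + a * y\<^sup>2) * (s + a) - (s + a * y)\<^sup>2 = s * a * (1 - y)\<^sup>2"
    by (simp add: power2_eq_square algebra_simps)
  also have "\<dots> \<ge> 0" using assms by simp
  finally have "s + a * y \<le> sqrt ((s + a * y\<^sup>2) * (s + a))"
    by (intro real_le_rsqrt) simp
  then have "s + a * y \<le> sqrt (s + a * y\<^sup>2) * sqrt (s + a)"
    by (simp add: real_sqrt_mult)
  then have "(s + a * y) / sqrt (s + a) \<le> sqrt (s + a * y\<^sup>2)"
    using pos by (simp add: pos_divide_le_eq)
  moreover have "sqrt (s + a) - a / sqrt (s + a) * (1 - y) = (s + a * y) / sqrt (s + a)"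
    using assms pos by (simp add: field_simps)
  ultimately show ?thesis by simp
qed

text \<open>
  The second conclusion, comparing the accumulated quadratic terms with \<open>partial_sigma\<close>, is what
  makes diminishing increments applicable in the induction step for the first.
\<close>

lemma ordered_linear_le_sqrt_quadratic:
  assumes "0 \<le> \<sigma>"
    and "\<And>i. i \<in> {1..k} \<Longrightarrow> 0 < a (p i) \<and> x (p i) \<in> {0, 1} \<and> 0 \<le> y (p i) \<and> y (p i) \<le> x (p i)"
  shows "sqrt \<sigma> + (\<Sum>i\<in>{1..k}.
        (sqrt (partial_sigma \<sigma> a p i) - sqrt (partial_sigma \<sigma> a p (i - 1))) * x (p i)
        - a (p i) / sqrt (partial_sigma \<sigma> a p i) * (x (p i) - y (p i)))
      \<le> sqrt (\<sigma> + (\<Sum>i\<in>{1..k}. a (p i) * (y (p i))\<^sup>2))"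
    and "\<sigma> + (\<Sum>i\<in>{1..k}. a (p i) * (y (p i))\<^sup>2) \<le> partial_sigma \<sigma> a p k"
  using assms(2)
proof (induction k)
  case 0
  {
    case 1
    then show ?case by simp
  next
    case 2
    then show ?case by simp
  }
next
  case (Suc k)
  let ?q = "p (Suc k)"
  let ?s = "partial_sigma \<sigma> a p k"
  let ?t = "\<sigma> + (\<Sum>i\<in>{1..k}. a (p i) * (y (p i))\<^sup>2)"
  {
    case 1
    have IH1: "sqrt \<sigma> + (\<Sum>i\<in>{1..k}.
        (sqrt (partial_sigma \<sigma> a p i) - sqrt (partial_sigma \<sigma> a p (i - 1))) * x (p i)
        - a (p i) / sqrt (partial_sigma \<sigma> a p i) * (x (p i) - y (p i))) \<le> sqrt ?t"
      using 1 by (intro Suc.IH(1)) simp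
    have ts: "?t \<le> ?s"
      using 1 by (intro Suc.IH(2)) simp
    have "0 \<le> (\<Sum>i\<in>{1..k}. a (p i) * (y (p i))\<^sup>2)"
      using 1 by (intro sum_nonneg mult_nonneg_nonneg) (auto simp: less_imp_le)
    then have t0: "0 \<le> ?t" using assms(1) by simp
    have q: "0 < a ?q" "x ?q \<in> {0, 1}" "0 \<le> y ?q" "y ?q \<le> x ?q"
      using 1[of "Suc k"] by auto
    have step: "(sqrt (?s + a ?q) - sqrt ?s) * x ?q - a ?q / sqrt (?s + a ?q) * (x ?q - y ?q)
        \<le> sqrt (?t + a ?q * (y ?q)\<^sup>2) - sqrt ?t"
    proof (cases "x ?q = 0")
      case True
      then show ?thesis using q by simp
    next
      case False
      then have "x ?q = 1" using q by auto
      moreover have "sqrt (?s + a ?q) - a ?q / sqrt (?s + a ?q) * (1 - y ?q)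
          \<le> sqrt (?s + a ?q * (y ?q)\<^sup>2)"
        using t0 ts q by (intro sqrt_quadratic_ge_tangent) auto
      moreover have "sqrt (?s + a ?q * (y ?q)\<^sup>2) - sqrt ?s \<le> sqrt (?t + a ?q * (y ?q)\<^sup>2) - sqrt ?t"
        using t0 ts q by (intro sqrt_increment_antimono) auto
      ultimately show ?thesis by simp
    qed
    then show ?case using IH1 by (simp add: add_ac)
  next
    case 2
    have "?t \<le> ?s"
      using 2 by (intro Suc.IH(2)) simp
    moreover have "a ?q * (y ?q)\<^sup>2 \<le> a ?q * 1"
      using 2[of "Suc k"] by (intro mult_left_mono power_le_one) auto
    ultimately show ?case by simp
  }
qed

theorem proposition7:
  fixes n :: nat and \<sigma> :: real and a :: "nat \<Rightarrow> real"
    and S :: "nat set" and p :: "nat \<Rightarrow> nat"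
  assumes "n \<ge> 1"
    and "\<sigma> \<ge> 0"
    and "\<And>i. i \<in> {1..n} \<Longrightarrow> a i > 0"
    and "S \<subseteq> {1..n}"
    and "bij_betw p {1..card S} S"
  shows "\<forall>(x, y, z) \<in> mixed_set n \<sigma> a.
    (max ((\<Sum>j\<in>S. pi_coeff \<sigma> a S p j * x j) + sqrt \<sigma>
          - (\<Sum>j\<in>S. alpha_coeff \<sigma> a S p j * (x j - y j))) 0)\<^sup>2
      + (\<Sum>i\<in>{1..n} - S. a i * (y i)\<^sup>2) \<le> z\<^sup>2"
proof clarify
  fix x y :: "nat \<Rightarrow> real" and z :: real
  assume "(x, y, z) \<in> mixed_set n \<sigma> a"
  then have x: "\<And>i. i \<in> {1..n} \<Longrightarrow> x i \<in> {0, 1}"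
    and y: "\<And>i. i \<in> {1..n} \<Longrightarrow> 0 \<le> y i \<and> y i \<le> x i"
    and z: "\<sigma> + (\<Sum>i\<in>{1..n}. a i * (y i)\<^sup>2) \<le> z\<^sup>2"
    unfolding mixed_set_def PiE_def Pi_def by blast+
  let ?L = "(\<Sum>j\<in>S. pi_coeff \<sigma> a S p j * x j) + sqrt \<sigma>
          - (\<Sum>j\<in>S. alpha_coeff \<sigma> a S p j * (x j - y j))"
  let ?Q = "\<Sum>i\<in>S. a i * (y i)\<^sup>2"
  have p: "p i \<in> {1..n}" if "i \<in> {1..card S}" for i
    using bij_betw_apply[OF assms(5) that] assms(4) by blast
  have "?L = sqrt \<sigma> + (\<Sum>j\<in>S. pi_coeff \<sigma> a S p j * x j - alpha_coeff \<sigma> a S p j * (x j - y j))"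
    by (simp add: sum_subtractf)
  also have "\<dots> = sqrt \<sigma> + (\<Sum>i\<in>{1..card S}. pi_coeff \<sigma> a S p (p i) * x (p i)
      - alpha_coeff \<sigma> a S p (p i) * (x (p i) - y (p i)))"
    by (simp add: sum.reindex_bij_betw[OF assms(5), symmetric])
  also have "\<dots> = sqrt \<sigma> + (\<Sum>i\<in>{1..card S}.
        (sqrt (partial_sigma \<sigma> a p i) - sqrt (partial_sigma \<sigma> a p (i - 1))) * x (p i)
        - a (p i) / sqrt (partial_sigma \<sigma> a p i) * (x (p i) - y (p i)))"
    by (intro arg_cong2[where f = "(+)"] refl sum.cong)
      (simp_all only: pi_coeff_at[OF assms(5)] alpha_coeff_at[OF assms(5)])
  also have "\<dots> \<le> sqrt (\<sigma> + (\<Sum>i\<in>{1..card S}. a (p i) * (y (p i))\<^sup>2))"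
    using p assms(3) x y by (intro ordered_linear_le_sqrt_quadratic assms(2)) blast
  also have "\<dots> = sqrt (\<sigma> + ?Q)"
    by (simp add: sum.reindex_bij_betw[OF assms(5), symmetric])
  finally have L: "?L \<le> sqrt (\<sigma> + ?Q)" .
  have "0 \<le> ?Q"
    using assms(3,4) by (intro sum_nonneg mult_nonneg_nonneg) (auto simp: subset_iff less_imp_le)
  then have nonneg: "0 \<le> \<sigma> + ?Q" using assms(2) by simp
  then have "(max ?L 0)\<^sup>2 \<le> (sqrt (\<sigma> + ?Q))\<^sup>2"
    using L by (intro power_mono) auto
  then have "(max ?L 0)\<^sup>2 \<le> \<sigma> + ?Q"
    using nonneg by simp
  moreover have "(\<Sum>i\<in>{1..n}. a i * (y i)\<^sup>2) = (\<Sum>i\<in>{1..n} - S. a i * (y i)\<^sup>2) + ?Q"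
    using assms(4) by (intro sum.subset_diff) auto
  ultimately show "(max ?L 0)\<^sup>2 + (\<Sum>i\<in>{1..n} - S. a i * (y i)\<^sup>2) \<le> z\<^sup>2"
    using z by linarith
qed

end
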